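(* Let $K$ be a field of characteristic $\ne 2$ and let $N$ be an indecomposable associative nil evolution $K$-algebra of dimension $\le 6$ with $\dim(\mathrm{ann}(N))=2$, written in a natural basis $\{e_i\}$ in one of the three normal forms $N_{5,9}(\alpha,\beta)$, $N_{6,17}(\alpha,\beta,\gamma)$, $N_{6,18}(\alpha,\beta,\gamma,\delta)$ listed in the context. Then the derivations of $N$ are exactly the linear maps $d$ of the following form, where the scalars $d_{ji}\in K$ that appear are arbitrary, and $\mathfrak{D}(N)$ is, as a vector space, as indicated: (1) $N=N_{5,9}(\alpha,\beta)$: $d(e_i)=d_{11}e_i+d_{4i}e_4+d_{5i}e_5$ for $i=1,2,3$, $d(e_4)=2d_{11}e_4$, $d(e_5)=2d_{11}e_5$; $\mathfrak{D}(N)\simeq K^4\times K^3$. (2) $N=N_{6,17}(\alpha,\beta,\gamma)$: $d(e_i)=d_{11}e_i+d_{5i}e_5+d_{6i}e_6$ for $i=1,2$, $d(e_3)=d_{11}e_3+d_{43}e_4+d_{53}e_5+d_{63}e_6$, $d(e_4)=-\gamma^{-1}d_{43}e_3+d_{11}e_4+d_{54}e_5+d_{64}e_6$, $d(e_5)=2d_{11}e_5$, $d(e_6)=2d_{11}e_6$; $\mathfrak{D}(N)\simeq K^6\times K^4$. (3) $N=N_{6,18}(\alpha,\beta,\gamma,\delta)$: $d(e_i)=d_{11}e_i+d_{5i}e_5+d_{6i}e_6$ for $i=1,2,3,4$, $d(e_5)=2d_{11}e_5$, $d(e_6)=2d_{11}e_6$; $\mathfrak{D}(N)\simeq K^5\times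 K^4$.
   Context: An evolution $K$-algebra is a finite-dimensional commutative (not necessarily associative) $K$-algebra with a basis $\{e_1,\dots,e_n\}$ (a natural basis) such that $e_ie_j=0$ for $i\neq j$. It is nil if for every $a$ some power $a^m$ is $0$; indecomposable if it is not a direct sum of two nonzero ideals; $\mathrm{ann}(N)=\{x\in N:xN=0\}$. $\mathfrak{D}(N)$ is the space of derivations, i.e. linear maps $d:N\to N$ with $d(uv)=ud(v)+d(u)v$. Known classification (from earlier work, to be taken as given): every indecomposable associative nil evolution algebra of dimension $\le 6$ with $2$-dimensional annihilator is isomorphic to one of the following (products $e_ie_j$, $i\neq j$, are zero): - $N_{5,9}(\alpha,\beta)$: $e_1^2=e_4$, $e_2^2=\alpha e_4+\beta e_5$, $e_3^2=e_5$, $e_4^2=e_5^2=0$, with $\alpha,\beta\in K^*$. - $N_{6,17}(\alpha,\beta,\gamma)$: $e_1^2=e_5$, $e_2^2=\alpha e_5+\beta e_6$, $e_3^2=\gamma e_6$, $e_4^2=e_6$, $e_5^2=e_6^2=0$, with $\alpha\beta\gamma\ne0$. - $N_{6,18}(\alpha,\beta,\gamma,\delta)$: $e_1^2=e_5$, $e_2^2=\alpha e_5+\beta e_6$, $e_3^2=\gamma e_5+\delta e_6$, $e_4^2=e_6$, $e_5^2=e_6^2=0$, with $\alpha\beta\ne0$, $\gamma\delta\neq0$, $\alpha\delta-\beta\gamma\neq0$. *)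

theory Defs
  imports "HOL-Analysis.Analysis" "HOL-Library.Function_Algebras"
begin

text \<open>A (not necessarily associative) algebra over the field \<open>'k\<close> is carried by a whole type
  \<open>'b\<close>, with scalar multiplication \<open>scl\<close> and a bilinear product \<open>mul\<close>.\<close>

locale nonassoc_algebra = vector_space scl
  for scl :: "'k::field \<Rightarrow> 'b::ab_group_add \<Rightarrow> 'b" +
  fixes mul :: "'b \<Rightarrow> 'b \<Rightarrow> 'b"
  assumes linear_mult_left: "Vector_Spaces.linear scl scl (\<lambda>x. mul x y)"
    and linear_mult_right: "Vector_Spaces.linear scl scl (mul x)"

text \<open>Basis vectors are indexed from 1, so the vector \<open>e\<^sub>i\<close> is \<open>e i\<close> for \<open>i \<in> {1..n}\<close>; the
  values of \<open>e\<close> outside this range are irrelevant.\<close>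

definition natural_basis ::
  "('k::field \<Rightarrow> 'b::ab_group_add \<Rightarrow> 'b) \<Rightarrow> ('b \<Rightarrow> 'b \<Rightarrow> 'b) \<Rightarrow> nat \<Rightarrow> (nat \<Rightarrow> 'b) \<Rightarrow> bool" where
  "natural_basis scl mul n e \<longleftrightarrow>
     inj_on e {1..n} \<and> \<not> module.dependent scl (e ` {1..n}) \<and>
     module.span scl (e ` {1..n}) = UNIV \<and>
     (\<forall>i\<in>{1..n}. \<forall>j\<in>{1..n}. i \<noteq> j \<longrightarrow> mul (e i) (e j) = 0)"

definition evolution_algebra ::
  "('k::field \<Rightarrow> 'b::ab_group_add \<Rightarrow> 'b) \<Rightarrow> ('b \<Rightarrow> 'b \<Rightarrow> 'b) \<Rightarrow> bool" where
  "evolution_algebra scl mul \<longleftrightarrow>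
     nonassoc_algebra scl mul \<and> (\<forall>x y. mul x y = mul y x) \<and>
     (\<exists>n e. natural_basis scl mul n e)"

definition associative_algebra :: "('b \<Rightarrow> 'b \<Rightarrow> 'b) \<Rightarrow> bool" where
  "associative_algebra mul \<longleftrightarrow> (\<forall>x y z. mul (mul x y) z = mul x (mul y z))"

text \<open>Principal powers, shifted by one because there need not be a unit:
  \<open>principal_power mul a m\<close> is the power of \<open>a\<close> with exponent \<open>m + 1\<close>.\<close>

primrec principal_power :: "('b \<Rightarrow> 'b \<Rightarrow> 'b) \<Rightarrow> 'b \<Rightarrow> nat \<Rightarrow> 'b" where
  "principal_power mul a 0 = a"
| "principal_power mul a (Suc m) = mul (principal_power mul a m) a"

definition nil_algebra :: "('b::zero \<Rightarrow> 'b \<Rightarrow> 'b) \<Rightarrow> bool" where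
  "nil_algebra mul \<longleftrightarrow> (\<forall>a. \<exists>m. principal_power mul a m = 0)"

definition algebra_ideal ::
  "('k::field \<Rightarrow> 'b::ab_group_add \<Rightarrow> 'b) \<Rightarrow> ('b \<Rightarrow> 'b \<Rightarrow> 'b) \<Rightarrow> 'b set \<Rightarrow> bool" where
  "algebra_ideal scl mul I \<longleftrightarrow>
     module.subspace scl I \<and> (\<forall>x\<in>I. \<forall>y. mul x y \<in> I \<and> mul y x \<in> I)"

definition indecomposable ::
  "('k::field \<Rightarrow> 'b::ab_group_add \<Rightarrow> 'b) \<Rightarrow> ('b \<Rightarrow> 'b \<Rightarrow> 'b) \<Rightarrow> bool" where
  "indecomposable scl mul \<longleftrightarrow>
     \<not> (\<exists>I J. algebra_ideal scl mul I \<and> algebra_ideal scl mul J \<and>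
             I \<noteq> {0} \<and> J \<noteq> {0} \<and> I \<inter> J = {0} \<and> {x + y | x y. x \<in> I \<and> y \<in> J} = UNIV)"

definition ann :: "('b::zero \<Rightarrow> 'b \<Rightarrow> 'b) \<Rightarrow> 'b set" where
  "ann mul = {x. \<forall>y. mul x y = 0}"

definition derivations ::
  "('k::field \<Rightarrow> 'b::ab_group_add \<Rightarrow> 'b) \<Rightarrow> ('b \<Rightarrow> 'b \<Rightarrow> 'b) \<Rightarrow> ('b \<Rightarrow> 'b) set" where
  "derivations scl mul =
     {d. Vector_Spaces.linear scl scl d \<and>
         (\<forall>u v. d (mul u v) = mul u (d v) + mul (d u) v)}"

definition N_5_9 ::
  "('k::field \<Rightarrow> 'b::ab_group_add \<Rightarrow> 'b) \<Rightarrow> ('b \<Rightarrow> 'b \<Rightarrow> 'b) \<Rightarrow> (nat \<Rightarrow> 'b) \<Rightarrow> 'k \<Rightarrow> 'k \<Rightarrow> bool" where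
  "N_5_9 scl mul e \<alpha> \<beta> \<longleftrightarrow>
     natural_basis scl mul 5 e \<and> \<alpha> \<noteq> 0 \<and> \<beta> \<noteq> 0 \<and>
     mul (e 1) (e 1) = e 4 \<and>
     mul (e 2) (e 2) = scl \<alpha> (e 4) + scl \<beta> (e 5) \<and>
     mul (e 3) (e 3) = e 5 \<and>
     mul (e 4) (e 4) = 0 \<and> mul (e 5) (e 5) = 0"

definition N_6_17 ::
  "('k::field \<Rightarrow> 'b::ab_group_add \<Rightarrow> 'b) \<Rightarrow> ('b \<Rightarrow> 'b \<Rightarrow> 'b) \<Rightarrow> (nat \<Rightarrow> 'b) \<Rightarrow> 'k \<Rightarrow> 'k \<Rightarrow> 'k \<Rightarrow> bool" where
  "N_6_17 scl mul e \<alpha> \<beta> \<gamma> \<longleftrightarrow>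
     natural_basis scl mul 6 e \<and> \<alpha> * \<beta> * \<gamma> \<noteq> 0 \<and>
     mul (e 1) (e 1) = e 5 \<and>
     mul (e 2) (e 2) = scl \<alpha> (e 5) + scl \<beta> (e 6) \<and>
     mul (e 3) (e 3) = scl \<gamma> (e 6) \<and>
     mul (e 4) (e 4) = e 6 \<and>
     mul (e 5) (e 5) = 0 \<and> mul (e 6) (e 6) = 0"

definition N_6_18 ::
  "('k::field \<Rightarrow> 'b::ab_group_add \<Rightarrow> 'b) \<Rightarrow> ('b \<Rightarrow> 'b \<Rightarrow> 'b) \<Rightarrow> (nat \<Rightarrow> 'b) \<Rightarrow>
   'k \<Rightarrow> 'k \<Rightarrow> 'k \<Rightarrow> 'k \<Rightarrow> bool" where
  "N_6_18 scl mul e \<alpha> \<beta> \<gamma> \<delta> \<longleftrightarrow>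
     natural_basis scl mul 6 e \<and>
     \<alpha> * \<beta> \<noteq> 0 \<and> \<gamma> * \<delta> \<noteq> 0 \<and> \<alpha> * \<delta> - \<beta> * \<gamma> \<noteq> 0 \<and>
     mul (e 1) (e 1) = e 5 \<and>
     mul (e 2) (e 2) = scl \<alpha> (e 5) + scl \<beta> (e 6) \<and>
     mul (e 3) (e 3) = scl \<gamma> (e 5) + scl \<delta> (e 6) \<and>
     mul (e 4) (e 4) = e 6 \<and>
     mul (e 5) (e 5) = 0 \<and> mul (e 6) (e 6) = 0"

definition subspaces_isomorphic ::
  "('k::field \<Rightarrow> 'u::ab_group_add \<Rightarrow> 'u) \<Rightarrow> 'u set \<Rightarrow>
   ('k \<Rightarrow> 'v::ab_group_add \<Rightarrow> 'v) \<Rightarrow> 'v set \<Rightarrow> bool" where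
  "subspaces_isomorphic s1 S s2 T \<longleftrightarrow>
     vector_space s1 \<and> vector_space s2 \<and> module.subspace s1 S \<and> module.subspace s2 T \<and>
     (\<exists>\<phi>. bij_betw \<phi> S T \<and>
          (\<forall>f\<in>S. \<forall>g\<in>S. \<phi> (f + g) = \<phi> f + \<phi> g) \<and>
          (\<forall>c. \<forall>f\<in>S. \<phi> (s1 c f) = s2 c (\<phi> f)))"

text \<open>Maps are added pointwise (the \<open>fun\<close> instance of Function Algebras) and scaled by:\<close>

definition fun_scale :: "('k \<Rightarrow> 'b \<Rightarrow> 'b) \<Rightarrow> 'k \<Rightarrow> ('a \<Rightarrow> 'b) \<Rightarrow> 'a \<Rightarrow> 'b" where
  "fun_scale scl c f = (\<lambda>x. scl c (f x))"

end

theory Submission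
  imports Defs
begin

text \<open>
  A derivation of an algebra with natural basis \<open>e\<^sub>1, \<dots>, e\<^sub>n\<close> is a linear map \<open>d\<close> that satisfies the
  Leibniz rule on pairs of basis vectors. Write \<open>d\<^sub>j\<^sub>i\<close> for the coefficient of \<open>e\<^sub>j\<close> in \<open>d(e\<^sub>i)\<close>.
  As \<open>e\<^sub>i x\<close> is the \<open>i\<close>-th coefficient of \<open>x\<close> times \<open>e\<^sub>i\<^sup>2\<close>, the rule becomes the linear system
  \<open>d\<^sub>i\<^sub>j e\<^sub>i\<^sup>2 + d\<^sub>j\<^sub>i e\<^sub>j\<^sup>2 = 0\<close> for \<open>i \<noteq> j\<close>, together with \<open>d(e\<^sub>i\<^sup>2) = 2 d\<^sub>i\<^sub>i e\<^sub>i\<^sup>2\<close>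
  (lemma \<open>derivation_iff\<close>).

  In each normal form the first family kills every off-diagonal entry between vectors with
  independent squares; the only pair with nonzero proportional squares is \<open>e\<^sub>3, e\<^sub>4\<close> in \<open>N\<^sub>6\<^sub>,\<^sub>1\<^sub>7\<close>, which
  leaves the parameter \<open>d\<^sub>4\<^sub>3\<close>. The second family says that all nonzero squares are eigenvectors of \<open>d\<close>.
  Two of them form a basis of the annihilator and a third one, \<open>e\<^sub>2\<^sup>2\<close>, is a combination of these two
  with both coefficients nonzero. Hence \<open>d\<close> acts on the annihilator as a single scalar, and since
  \<open>2 \<noteq> 0\<close> all \<open>d\<^sub>i\<^sub>i\<close> with \<open>e\<^sub>i\<^sup>2 \<noteq> 0\<close> agree. The entries into the annihilator remain free.

  The free entries \<open>d\<^sub>j\<^sub>i\<close> are linear coordinates on the space of derivations, so that space is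
  isomorphic to \<open>K\<^sup>r \<times> K\<^sup>s\<close> as soon as \<open>r + s\<close> is their number
  (lemma \<open>subspaces_isomorphic_by_coordinates\<close>).
\<close>

section \<open>Subspaces with a finite system of linear coordinates\<close>

lemma two_neq_zero_if_CHAR_neq_2:
  assumes "CHAR('k::field) \<noteq> 2"
  shows "(2::'k) \<noteq> 0"
proof
  assume "(2::'k) = 0"
  then have "CHAR('k) dvd 2"
    using of_nat_eq_0_iff_char_dvd[of 2, where 'a = 'k] by simp
  then have "CHAR('k) = 1"
    using assms by (auto dest: prime_nat_iff[THEN iffD1, OF two_is_prime_nat, THEN conjunct2, rule_format])
  then show False
    using CHAR_not_1[where 'a = 'k] by simp
qed

lemma vector_space_fun_scale:
  assumes "vector_space scl"
  shows "vector_space (fun_scale scl)"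
proof -
  interpret vector_space scl by fact
  show ?thesis
    by unfold_locales
      (auto simp: fun_scale_def fun_eq_iff scale_right_distrib scale_left_distrib)
qed

text \<open>The target splits the coordinate set \<open>X\<close> along an arbitrary bijection with \<open>'m + 'p\<close>; only the
  number of coordinates matters.\<close>

lemma subspaces_isomorphic_by_coordinates:
  fixes s :: "'k::field \<Rightarrow> 'u::ab_group_add \<Rightarrow> 'u" and \<theta> :: "'u \<Rightarrow> 'x \<Rightarrow> 'k"
  assumes "vector_space s" and "module.subspace s S"
    and add: "\<And>f g x. f \<in> S \<Longrightarrow> g \<in> S \<Longrightarrow> x \<in> X \<Longrightarrow> \<theta> (f + g) x = \<theta> f x + \<theta> g x"
    and scale: "\<And>c f x. f \<in> S \<Longrightarrow> x \<in> X \<Longrightarrow> \<theta> (s c f) x = c * \<theta> f x"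
    and inj: "\<And>f g. f \<in> S \<Longrightarrow> g \<in> S \<Longrightarrow> (\<And>x. x \<in> X \<Longrightarrow> \<theta> f x = \<theta> g x) \<Longrightarrow> f = g"
    and surj: "\<And>c. \<exists>f\<in>S. \<forall>x\<in>X. \<theta> f x = c x"
    and card: "card X = CARD('m::finite) + CARD('p::finite)"
  shows "subspaces_isomorphic s S (module_prod.scale (*s) (*s)) (UNIV :: (('k^'m) \<times> ('k^'p)) set)"
proof -
  interpret P: vector_space_pair "(*s) :: 'k \<Rightarrow> 'k^'m \<Rightarrow> 'k^'m" "(*s) :: 'k \<Rightarrow> 'k^'p \<Rightarrow> 'k^'p"
    by unfold_locales
  interpret P: vector_space_prod "(*s) :: 'k \<Rightarrow> 'k^'m \<Rightarrow> 'k^'m" "(*s) :: 'k \<Rightarrow> 'k^'p \<Rightarrow> 'k^'p"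
    by unfold_locales
  have "card X \<noteq> 0" using card by simp
  then have "finite X" by (meson card.infinite)
  moreover have "card (UNIV :: ('m + 'p) set) = card X"
    using card by (simp add: card_UNIV_sum)
  ultimately obtain h :: "'m + 'p \<Rightarrow> 'x" where h: "bij_betw h UNIV X"
    using finite_same_card_bij[of "UNIV :: ('m + 'p) set" X] by auto
  have hX [simp]: "h z \<in> X" for z
    using h by (auto simp: bij_betw_def)
  define \<phi> :: "'u \<Rightarrow> ('k^'m) \<times> ('k^'p)"
    where "\<phi> f = (\<chi> i. \<theta> f (h (Inl i)), \<chi> j. \<theta> f (h (Inr j)))" for f
  have "inj_on \<phi> S"
  proof (rule inj_onI)
    fix f g assume fg: "f \<in> S" "g \<in> S" and eq: "\<phi> f = \<phi> g"
    have "\<theta> f (h z) = \<theta> g (h z)" for z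
      using eq by (cases z) (auto simp: \<phi>_def vec_eq_iff)
    then have "\<theta> f x = \<theta> g x" if "x \<in> X" for x
      using h that by (auto simp: bij_betw_def)
    then show "f = g" by (rule inj[OF fg])
  qed
  moreover have "w \<in> \<phi> ` S" for w
  proof -
    obtain a b where w: "w = (a, b)" by (cases w)
    obtain f where f: "f \<in> S"
      "\<And>x. x \<in> X \<Longrightarrow> \<theta> f x = case_sum (\<lambda>i. a $ i) (\<lambda>j. b $ j) (the_inv h x)"
      using surj[of "\<lambda>x. case_sum (\<lambda>i. a $ i) (\<lambda>j. b $ j) (the_inv h x)"] by blast
    have "the_inv h (h z) = z" for z
      using h by (simp add: bij_betw_def the_inv_f_f)
    then have "\<phi> f = w"
      using f(2) by (simp add: \<phi>_def w vec_eq_iff)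
    then show ?thesis using f(1) by blast
  qed
  ultimately have "bij_betw \<phi> S UNIV"
    by (auto simp: bij_betw_def)
  moreover have "\<phi> (f + g) = \<phi> f + \<phi> g" if "f \<in> S" "g \<in> S" for f g
    using that by (simp add: \<phi>_def add vec_eq_iff)
  moreover have "\<phi> (s c f) = P.scale c (\<phi> f)" if "f \<in> S" for c f
    using that by (simp add: \<phi>_def scale P.scale_def vec_eq_iff)
  ultimately show ?thesis
    unfolding subspaces_isomorphic_def
    using assms(1,2) P.p.vector_space_axioms P.p.subspace_UNIV by blast
qed

section \<open>Derivations in a natural basis\<close>

locale natural_basis_algebra = nonassoc_algebra scl mul
  for scl :: "'k::field \<Rightarrow> 'b::ab_group_add \<Rightarrow> 'b" and mul :: "'b \<Rightarrow> 'b \<Rightarrow> 'b" +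
  fixes n :: nat and e :: "nat \<Rightarrow> 'b"
  assumes natural: "natural_basis scl mul n e"
begin

sublocale vector_space_pair scl scl
  by unfold_locales

definition coeff :: "'b \<Rightarrow> nat \<Rightarrow> 'k" where
  "coeff x i = representation (e ` {1..n}) x (e i)"

lemma
  shows inj_basis: "inj_on e {1..n}"
    and indep_basis: "independent (e ` {1..n})"
    and span_basis: "span (e ` {1..n}) = UNIV"
    and mul_basis: "i \<in> {1..n} \<Longrightarrow> j \<in> {1..n} \<Longrightarrow> i \<noteq> j \<Longrightarrow> mul (e i) (e j) = 0"
  using natural unfolding natural_basis_def by blast+

lemma
  shows coeff_zero: "coeff 0 i = 0"
    and coeff_add: "coeff (x + y) i = coeff x i + coeff y i"
    and coeff_diff: "coeff (x - y) i = coeff x i - coeff y i"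
    and coeff_scale: "coeff (scl c x) i = c * coeff x i"
  using indep_basis span_basis
  by (simp_all add: coeff_def representation_zero representation_add representation_diff
      representation_scale)

lemma coeff_basis:
  assumes "i \<in> {1..n}" "j \<in> {1..n}"
  shows "coeff (e j) i = (if i = j then 1 else 0)"
  using assms inj_basis indep_basis
  by (auto simp: coeff_def representation_basis inj_on_eq_iff)

lemmas coeff_simps = coeff_zero coeff_add coeff_diff coeff_scale coeff_basis

lemma basis_expansion: "x = (\<Sum>i\<in>{1..n}. scl (coeff x i) (e i))"
proof -
  have "(\<Sum>b\<in>e ` {1..n}. scl (representation (e ` {1..n}) x b) b) = x"
    using indep_basis span_basis by (intro sum_representation_eq) auto
  then show ?thesis
    by (simp only: sum.reindex[OF inj_basis] coeff_def o_def)
qed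

lemma linear_eq_if_eq_on_basis:
  assumes "Vector_Spaces.linear scl scl f" "Vector_Spaces.linear scl scl g"
    and "\<And>i. i \<in> {1..n} \<Longrightarrow> f (e i) = g (e i)"
  shows "f = g"
proof
  show "f x = g x" for x
    using assms span_basis by (intro linear_eq_on[of f g x "e ` {1..n}"]) auto
qed

lemma linear_extension_of_basis_values:
  "\<exists>d. Vector_Spaces.linear scl scl d \<and> (\<forall>i\<in>{1..n}. d (e i) = f i)"
  using linear_independent_extend[OF indep_basis, of "\<lambda>b. f (the_inv_into {1..n} e b)"] inj_basis
  by (auto simp: the_inv_into_f_f)

lemma
  shows mul_zero_left: "mul 0 y = 0" and mul_zero_right: "mul x 0 = 0"
    and mul_add_left: "mul (x + x') y = mul x y + mul x' y"
    and mul_add_right: "mul x (y + y') = mul x y + mul x y'"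
    and mul_scale_left: "mul (scl c x) y = scl c (mul x y)"
    and mul_scale_right: "mul x (scl c y) = scl c (mul x y)"
    and mul_sum_left: "mul (sum f I) y = (\<Sum>i\<in>I. mul (f i) y)"
    and mul_sum_right: "mul x (sum g I) = (\<Sum>i\<in>I. mul x (g i))"
proof -
  interpret L: Vector_Spaces.linear scl scl "\<lambda>x. mul x y" by (rule linear_mult_left)
  interpret R: Vector_Spaces.linear scl scl "mul x" by (rule linear_mult_right)
  show "mul 0 y = 0" "mul (x + x') y = mul x y + mul x' y" "mul (scl c x) y = scl c (mul x y)"
    "mul (sum f I) y = (\<Sum>i\<in>I. mul (f i) y)"
    by (fact L.zero L.add L.scale L.sum)+
  show "mul x 0 = 0" "mul x (y + y') = mul x y + mul x y'" "mul x (scl c y) = scl c (mul x y)"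
    "mul x (sum g I) = (\<Sum>i\<in>I. mul x (g i))"
    by (fact R.zero R.add R.scale R.sum)+
qed

lemma
  assumes i: "i \<in> {1..n}"
  shows mul_basis_right: "mul x (e i) = scl (coeff x i) (mul (e i) (e i))"
    and mul_basis_left: "mul (e i) x = scl (coeff x i) (mul (e i) (e i))"
proof -
  have "mul x (e i) = (\<Sum>j\<in>{1..n}. scl (coeff x j) (mul (e j) (e i)))"
    by (subst basis_expansion) (simp add: mul_sum_left mul_scale_left)
  also have "\<dots> = (\<Sum>j\<in>{1..n}. if j = i then scl (coeff x i) (mul (e i) (e i)) else 0)"
    using i by (intro sum.cong) (auto simp: mul_basis)
  finally show "mul x (e i) = scl (coeff x i) (mul (e i) (e i))"
    using i by simp
  have "mul (e i) x = (\<Sum>j\<in>{1..n}. scl (coeff x j) (mul (e i) (e j)))"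
    by (subst basis_expansion) (simp add: mul_sum_right mul_scale_right)
  also have "\<dots> = (\<Sum>j\<in>{1..n}. if j = i then scl (coeff x i) (mul (e i) (e i)) else 0)"
    using i by (intro sum.cong) (auto simp: mul_basis)
  finally show "mul (e i) x = scl (coeff x i) (mul (e i) (e i))"
    using i by simp
qed

text \<open>Both sides of the Leibniz rule are bilinear, so it suffices to test basis vectors.\<close>

lemma derivation_iff_basis:
  assumes lin: "Vector_Spaces.linear scl scl d"
  shows "d \<in> derivations scl mul \<longleftrightarrow>
    (\<forall>i\<in>{1..n}. \<forall>j\<in>{1..n}. d (mul (e i) (e j)) = mul (e i) (d (e j)) + mul (d (e i)) (e j))"
proof
  assume "d \<in> derivations scl mul"
  then show "\<forall>i\<in>{1..n}. \<forall>j\<in>{1..n}.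
      d (mul (e i) (e j)) = mul (e i) (d (e j)) + mul (d (e i)) (e j)"
    by (simp add: derivations_def)
next
  assume basis: "\<forall>i\<in>{1..n}. \<forall>j\<in>{1..n}.
      d (mul (e i) (e j)) = mul (e i) (d (e j)) + mul (d (e i)) (e j)"
  have d: "d (x + y) = d x + d y" "d (scl c x) = scl c (d x)" for x y c
    using lin by (simp_all add: Vector_Spaces.linear_iff)
  have left: "Vector_Spaces.linear scl scl (\<lambda>u. d (mul u v))"
    "Vector_Spaces.linear scl scl (\<lambda>u. mul u (d v) + mul (d u) v)" for v
    by (auto simp: Vector_Spaces.linear_iff vector_space_axioms mul_add_left mul_scale_left d
        scale_right_distrib)
  have right: "Vector_Spaces.linear scl scl (\<lambda>v. d (mul u v))"
    "Vector_Spaces.linear scl scl (\<lambda>v. mul u (d v) + mul (d u) v)" for u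
    by (auto simp: Vector_Spaces.linear_iff vector_space_axioms mul_add_right mul_scale_right d
        scale_right_distrib)
  have "(\<lambda>v. d (mul (e i) v)) = (\<lambda>v. mul (e i) (d v) + mul (d (e i)) v)"
    if "i \<in> {1..n}" for i
    using basis that by (intro linear_eq_if_eq_on_basis right) blast
  then have "(\<lambda>u. d (mul u v)) = (\<lambda>u. mul u (d v) + mul (d u) v)" for v
    by (intro linear_eq_if_eq_on_basis left) meson
  then show "d \<in> derivations scl mul"
    using lin unfolding derivations_def by (auto dest: fun_cong)
qed

text \<open>The two sides of the Leibniz rule at \<open>e\<^sub>i, e\<^sub>j\<close> are \<open>d(e\<^sub>i e\<^sub>j)\<close> and
  \<open>d\<^sub>i\<^sub>j e\<^sub>i\<^sup>2 + d\<^sub>j\<^sub>i e\<^sub>j\<^sup>2\<close>; the latter is symmetric in \<open>i\<close> and \<open>j\<close>, whence the restriction to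
  \<open>i < j\<close>.\<close>

lemma derivation_iff:
  assumes lin: "Vector_Spaces.linear scl scl d"
  shows "d \<in> derivations scl mul \<longleftrightarrow>
    (\<forall>i\<in>{1..n}. \<forall>j\<in>{1..n}. i < j \<longrightarrow>
      scl (coeff (d (e j)) i) (mul (e i) (e i)) + scl (coeff (d (e i)) j) (mul (e j) (e j)) = 0) \<and>
    (\<forall>i\<in>{1..n}. d (mul (e i) (e i)) = scl (2 * coeff (d (e i)) i) (mul (e i) (e i)))"
    (is "_ \<longleftrightarrow> (\<forall>i\<in>_. \<forall>j\<in>_. i < j \<longrightarrow> ?L i j = 0) \<and> ?R")
proof -
  have d0: "d 0 = 0" using lin by (rule linear_0)
  have double: "scl (2 * c) x = scl c x + scl c x" for c x
    by (simp only: mult_2 scale_left_distrib)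
  have leibniz: "mul (e i) (d (e j)) + mul (d (e i)) (e j) = ?L i j"
    if "i \<in> {1..n}" "j \<in> {1..n}" for i j
    using that by (simp add: mul_basis_left[of i "d (e j)"] mul_basis_right[of j "d (e i)"])
  have sym: "?L i j = ?L j i" for i j
    by (rule add.commute)
  have "d \<in> derivations scl mul \<longleftrightarrow>
      (\<forall>i\<in>{1..n}. \<forall>j\<in>{1..n}. d (mul (e i) (e j)) = ?L i j)"
    unfolding derivation_iff_basis[OF lin] by (intro ball_cong refl) (simp only: leibniz)
  also have "\<dots> \<longleftrightarrow> (\<forall>i\<in>{1..n}. \<forall>j\<in>{1..n}. i \<noteq> j \<longrightarrow> ?L i j = 0) \<and> ?R"
  proof (intro iffI conjI ballI impI; (elim conjE)?)
    fix i j assume "\<forall>i\<in>{1..n}. \<forall>j\<in>{1..n}. d (mul (e i) (e j)) = ?L i j"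
      and "i \<in> {1..n}" "j \<in> {1..n}" "i \<noteq> j"
    then show "?L i j = 0" by (metis d0 mul_basis)
  next
    fix i assume "\<forall>i\<in>{1..n}. \<forall>j\<in>{1..n}. d (mul (e i) (e j)) = ?L i j" and "i \<in> {1..n}"
    then show "d (mul (e i) (e i)) = scl (2 * coeff (d (e i)) i) (mul (e i) (e i))"
      by (simp only: double)
  next
    fix i j assume "\<forall>i\<in>{1..n}. \<forall>j\<in>{1..n}. i \<noteq> j \<longrightarrow> ?L i j = 0" ?R "i \<in> {1..n}" "j \<in> {1..n}"
    then show "d (mul (e i) (e j)) = ?L i j"
      by (cases "i = j") (simp_all add: mul_basis d0 double)
  qed
  also have "(\<forall>i\<in>{1..n}. \<forall>j\<in>{1..n}. i \<noteq> j \<longrightarrow> ?L i j = 0) \<longleftrightarrow>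
      (\<forall>i\<in>{1..n}. \<forall>j\<in>{1..n}. i < j \<longrightarrow> ?L i j = 0)"
    using sym by (metis linorder_neqE_nat nat_neq_iff)
  finally show ?thesis .
qed

lemma
  assumes d: "d \<in> derivations scl mul" and i: "i \<in> {1..n}"
  shows derivation_square: "d (mul (e i) (e i)) = scl (2 * coeff (d (e i)) i) (mul (e i) (e i))"
    and derivation_off_diagonal: "j \<in> {1..n} \<Longrightarrow> i < j \<Longrightarrow>
      coeff (d (e j)) i * coeff (mul (e i) (e i)) k + coeff (d (e i)) j * coeff (mul (e j) (e j)) k = 0"
proof -
  have lin: "Vector_Spaces.linear scl scl d"
    using d by (simp add: derivations_def)
  show "d (mul (e i) (e i)) = scl (2 * coeff (d (e i)) i) (mul (e i) (e i))"
    using derivation_iff[OF lin] d i by blast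
  assume "j \<in> {1..n}" "i < j"
  then have "scl (coeff (d (e j)) i) (mul (e i) (e i)) + scl (coeff (d (e i)) j) (mul (e j) (e j)) = 0"
    using derivation_iff[OF lin] d i by blast
  from arg_cong[OF this, of "\<lambda>x. coeff x k"]
  show "coeff (d (e j)) i * coeff (mul (e i) (e i)) k + coeff (d (e i)) j * coeff (mul (e j) (e j)) k = 0"
    by (simp add: coeff_simps)
qed

lemma subspace_derivations: "module.subspace (fun_scale scl) (derivations scl mul)"
proof -
  interpret F: vector_space "fun_scale scl"
    by (rule vector_space_fun_scale) (rule vector_space_axioms)
  show ?thesis
    by (auto simp: F.subspace_def derivations_def Vector_Spaces.linear_iff vector_space_axioms fun_scale_def
        scale_right_distrib mul_zero_left mul_zero_right mul_add_left mul_add_right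
        mul_scale_left mul_scale_right scale_left_commute)
qed

text \<open>Free entries of the matrix of \<open>d\<close> serve as coordinates: a derivation is determined by its values
  on the basis, hence by its entries at \<open>X\<close>, and linear extension from the basis realises every choice
  of these entries. Here \<open>F D i\<close> is the prescribed image of \<open>e\<^sub>i\<close>.\<close>

lemma derivations_isomorphic_if_free_entries:
  fixes F :: "(nat \<Rightarrow> nat \<Rightarrow> 'k) \<Rightarrow> nat \<Rightarrow> 'b"
  assumes der: "derivations scl mul =
      {d. Vector_Spaces.linear scl scl d \<and> (\<exists>D. \<forall>i\<in>{1..n}. d (e i) = F D i)}"
    and X: "snd ` X \<subseteq> {1..n}" "card X = CARD('m::finite) + CARD('p::finite)"
    and entry: "\<And>D j i. (j, i) \<in> X \<Longrightarrow> coeff (F D i) j = D j i"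
    and dependence: "\<And>D D' i. (\<And>j l. (j, l) \<in> X \<Longrightarrow> D j l = D' j l) \<Longrightarrow> i \<in> {1..n} \<Longrightarrow> F D i = F D' i"
  shows "subspaces_isomorphic (fun_scale scl) (derivations scl mul)
    (module_prod.scale (*s) (*s)) (UNIV :: (('k^'m) \<times> ('k^'p)) set)"
proof (rule subspaces_isomorphic_by_coordinates[where X = X and \<theta> = "\<lambda>d (j, i). coeff (d (e i)) j"])
  show "vector_space (fun_scale scl)"
    by (rule vector_space_fun_scale) (rule vector_space_axioms)
  show "module.subspace (fun_scale scl) (derivations scl mul)"
    by (rule subspace_derivations)
  show "(case x of (j, i) \<Rightarrow> coeff ((f + g) (e i)) j) =
      (case x of (j, i) \<Rightarrow> coeff (f (e i)) j) + (case x of (j, i) \<Rightarrow> coeff (g (e i)) j)" for f g x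
    by (simp add: coeff_add split: prod.split)
  show "(case x of (j, i) \<Rightarrow> coeff (fun_scale scl c f (e i)) j) =
      c * (case x of (j, i) \<Rightarrow> coeff (f (e i)) j)" for c f x
    by (simp add: fun_scale_def coeff_scale split: prod.split)
  show "f = g" if fg: "f \<in> derivations scl mul" "g \<in> derivations scl mul"
    and eq: "\<And>x. x \<in> X \<Longrightarrow>
      (case x of (j, i) \<Rightarrow> coeff (f (e i)) j) = (case x of (j, i) \<Rightarrow> coeff (g (e i)) j)" for f g
  proof -
    obtain D D' where lin: "Vector_Spaces.linear scl scl f" "Vector_Spaces.linear scl scl g"
      and D: "\<And>i. i \<in> {1..n} \<Longrightarrow> f (e i) = F D i" "\<And>i. i \<in> {1..n} \<Longrightarrow> g (e i) = F D' i"
      using fg unfolding der by blast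
    have "D j l = D' j l" if "(j, l) \<in> X" for j l
    proof -
      have "l \<in> {1..n}" using X(1) that by force
      then show ?thesis
        using eq[OF that] entry[OF that, of D] entry[OF that, of D'] D by simp
    qed
    then have "F D i = F D' i" if "i \<in> {1..n}" for i
      using that by (rule dependence)
    with lin D show ?thesis
      by (intro linear_eq_if_eq_on_basis) auto
  qed
  show "\<exists>f\<in>derivations scl mul. \<forall>x\<in>X. (case x of (j, i) \<Rightarrow> coeff (f (e i)) j) = c x" for c
  proof -
    obtain f where f: "Vector_Spaces.linear scl scl f"
      "\<And>i. i \<in> {1..n} \<Longrightarrow> f (e i) = F (\<lambda>j i. c (j, i)) i"
      using linear_extension_of_basis_values[of "F (\<lambda>j i. c (j, i))"] by blast
    then have "f \<in> derivations scl mul"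
      unfolding der by blast
    moreover have "coeff (f (e i)) j = c (j, i)" if "(j, i) \<in> X" for j i
    proof -
      have "i \<in> {1..n}" using X(1) that by force
      then show ?thesis using f(2) entry[OF that] by simp
    qed
    ultimately show ?thesis by (intro bexI[of _ f]) auto
  qed
qed (fact X(2))

text \<open>Nonzero squares \<open>e\<^sub>i\<^sup>2\<close> are eigenvectors of \<open>d\<close> with eigenvalue \<open>2 d\<^sub>i\<^sub>i\<close>. An eigenvector in the span
  of two independent eigenvectors shares its eigenvalue with each of them that occurs in it, and the
  factor \<open>2\<close> cancels.\<close>

lemma derivation_diagonal_eq:
  assumes two: "(2::'k) \<noteq> 0" and d: "d \<in> derivations scl mul"
    and ij: "i \<in> {1..n}" "j \<in> {1..n}" "k \<in> {1..n}" "p \<in> {1..n}" "q \<in> {1..n}" "p \<noteq> q"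
    and sq: "mul (e i) (e i) = e p" "mul (e j) (e j) = e q"
      "mul (e k) (e k) = scl a (e p) + scl b (e q)"
  shows "a \<noteq> 0 \<Longrightarrow> coeff (d (e k)) k = coeff (d (e i)) i"
    and "b \<noteq> 0 \<Longrightarrow> coeff (d (e k)) k = coeff (d (e j)) j"
proof -
  have lin: "d (x + y) = d x + d y" "d (scl c x) = scl c (d x)" for x y c
    using d by (simp_all add: derivations_def Vector_Spaces.linear_iff)
  have "d (e p) = scl (2 * coeff (d (e i)) i) (e p)" "d (e q) = scl (2 * coeff (d (e j)) j) (e q)"
    using derivation_square[OF d] ij sq by metis+
  then have "scl (2 * coeff (d (e k)) k) (scl a (e p) + scl b (e q)) =
      scl a (scl (2 * coeff (d (e i)) i) (e p)) + scl b (scl (2 * coeff (d (e j)) j) (e q))"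
    using derivation_square[OF d ij(3)] unfolding sq(3) by (simp add: lin)
  note eq = arg_cong[OF this, of "\<lambda>x. coeff x p"] arg_cong[OF this, of "\<lambda>x. coeff x q"]
  show "coeff (d (e k)) k = coeff (d (e i)) i" if "a \<noteq> 0"
    using eq(1) ij two that by (simp add: coeff_simps)
  show "coeff (d (e k)) k = coeff (d (e j)) j" if "b \<noteq> 0"
    using eq(2) ij two that by (simp add: coeff_simps)
qed

end

section \<open>The three normal forms\<close>

lemma natural_basis_algebraI:
  "evolution_algebra scl mul \<Longrightarrow> natural_basis scl mul n e \<Longrightarrow> natural_basis_algebra scl mul n e"
  by (simp add: evolution_algebra_def natural_basis_algebra_def natural_basis_algebra_axioms_def)

text \<open>The squares of \<open>e\<^sub>1, e\<^sub>2, e\<^sub>3\<close> are pairwise independent because \<open>\<alpha>\<close> and \<open>\<beta>\<close> are nonzero, so the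
  free entries are the common diagonal one and the six that lead into the annihilator.\<close>

lemma derivations_N_5_9:
  fixes scl :: "'k::field \<Rightarrow> 'b::ab_group_add \<Rightarrow> 'b"
  assumes "evolution_algebra scl mul" and N: "N_5_9 scl mul e \<alpha> \<beta>" and two: "(2::'k) \<noteq> 0"
  shows "derivations scl mul =
      {d. Vector_Spaces.linear scl scl d \<and>
          (\<exists>D :: nat \<Rightarrow> nat \<Rightarrow> 'k.
             (\<forall>i\<in>{1,2,3}. d (e i) = scl (D 1 1) (e i) + scl (D 4 i) (e 4) + scl (D 5 i) (e 5)) \<and>
             d (e 4) = scl (2 * D 1 1) (e 4) \<and>
             d (e 5) = scl (2 * D 1 1) (e 5))}" (is "_ = ?R")
    and "subspaces_isomorphic (fun_scale scl) (derivations scl mul)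
      (module_prod.scale (*s) (*s)) (UNIV :: (('k^4) \<times> ('k^3)) set)"
proof -
  note [simp del] = One_nat_def
  have ab: "\<alpha> \<noteq> 0" "\<beta> \<noteq> 0" and nb: "natural_basis scl mul 5 e"
    and sq: "mul (e 1) (e 1) = e 4" "mul (e 2) (e 2) = scl \<alpha> (e 4) + scl \<beta> (e 5)"
      "mul (e 3) (e 3) = e 5" "mul (e 4) (e 4) = 0" "mul (e 5) (e 5) = 0"
    using N by (simp_all add: N_5_9_def)
  interpret natural_basis_algebra scl mul 5 e
    using assms(1) nb by (rule natural_basis_algebraI)
  have idx: "{1..5} = {1, 2, 3, 4, 5::nat}" by auto
  show der: "derivations scl mul = ?R"
  proof (intro set_eqI iffI)
    fix d assume d: "d \<in> derivations scl mul"
    then have lin: "Vector_Spaces.linear scl scl d"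
      by (simp add: derivations_def)
    let ?D = "\<lambda>j i. coeff (d (e i)) j"
    have diag: "?D 2 2 = ?D 1 1" "?D 3 3 = ?D 1 1"
      using derivation_diagonal_eq[OF two d, of 1 3 2 4 5 \<alpha> \<beta>] ab sq by auto
    note off = derivation_off_diagonal[OF d]
    have "?D 2 1 = 0" "?D 1 2 = 0"
      using off[of 1 2 4] off[of 1 2 5] ab by (auto simp: sq coeff_simps)
    moreover have "?D 3 1 = 0" "?D 1 3 = 0"
      using off[of 1 3 4] off[of 1 3 5] by (auto simp: sq coeff_simps)
    moreover have "?D 3 2 = 0" "?D 2 3 = 0"
      using off[of 2 3 4] off[of 2 3 5] ab by (auto simp: sq coeff_simps)
    ultimately have "\<forall>i\<in>{1,2,3}. d (e i) = scl (?D 1 1) (e i) + scl (?D 4 i) (e 4) + scl (?D 5 i) (e 5)"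
      using basis_expansion[of "d (e 1)"] basis_expansion[of "d (e 2)"] basis_expansion[of "d (e 3)"] diag
      by (simp add: idx add.assoc)
    moreover have "d (e 4) = scl (2 * ?D 1 1) (e 4)" "d (e 5) = scl (2 * ?D 1 1) (e 5)"
      using derivation_square[OF d, of 1] derivation_square[OF d, of 3] diag by (simp_all add: sq)
    ultimately show "d \<in> ?R"
      using lin by (intro CollectI conjI exI[of _ ?D])
  next
    fix d assume "d \<in> ?R"
    then obtain D :: "nat \<Rightarrow> nat \<Rightarrow> 'k" where lin: "Vector_Spaces.linear scl scl d"
      and D: "\<forall>i\<in>{1,2,3}. d (e i) = scl (D 1 1) (e i) + scl (D 4 i) (e 4) + scl (D 5 i) (e 5)"
        "d (e 4) = scl (2 * D 1 1) (e 4)" "d (e 5) = scl (2 * D 1 1) (e 5)"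
      by blast
    have "d (x + y) = d x + d y" "d (scl c x) = scl c (d x)" "d 0 = 0" for x y c
      using lin by (simp_all add: Vector_Spaces.linear_iff linear_0)
    with D show "d \<in> derivations scl mul"
      unfolding derivation_iff[OF lin] idx
      by (simp add: coeff_simps sq scale_right_distrib mult_ac)
  qed
  define F :: "(nat \<Rightarrow> nat \<Rightarrow> 'k) \<Rightarrow> nat \<Rightarrow> 'b" where
    "F D i = (if i \<in> {1,2,3} then scl (D 1 1) (e i) + scl (D 4 i) (e 4) + scl (D 5 i) (e 5)
      else scl (2 * D 1 1) (e i))" for D i
  let ?X = "insert (1, 1) ({4, 5} \<times> {1, 2, 3}) :: (nat \<times> nat) set"
  show "subspaces_isomorphic (fun_scale scl) (derivations scl mul)
      (module_prod.scale (*s) (*s)) (UNIV :: (('k^4) \<times> ('k^3)) set)"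
  proof (rule derivations_isomorphic_if_free_entries[where X = ?X and F = F])
    show "derivations scl mul =
        {d. Vector_Spaces.linear scl scl d \<and> (\<exists>D. \<forall>i\<in>{1..5}. d (e i) = F D i)}"
      unfolding der F_def idx by simp
    show "card ?X = CARD(4) + CARD(3)" by simp
  qed (auto simp: F_def coeff_simps)
qed

text \<open>Here \<open>e\<^sub>3\<^sup>2 = \<gamma> e\<^sub>4\<^sup>2\<close>, so the pair \<open>e\<^sub>3, e\<^sub>4\<close> only yields \<open>\<gamma> d\<^sub>3\<^sub>4 + d\<^sub>4\<^sub>3 = 0\<close>: infinitesimally, \<open>d\<close>
  may rotate the plane of \<open>e\<^sub>3\<close> and \<open>e\<^sub>4\<close>. Besides \<open>d\<^sub>4\<^sub>3\<close>, the free entries are the common diagonal one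
  and the eight that lead into the annihilator.\<close>

lemma derivations_N_6_17:
  fixes scl :: "'k::field \<Rightarrow> 'b::ab_group_add \<Rightarrow> 'b"
  assumes "evolution_algebra scl mul" and N: "N_6_17 scl mul e \<alpha> \<beta> \<gamma>" and two: "(2::'k) \<noteq> 0"
  shows "derivations scl mul =
      {d. Vector_Spaces.linear scl scl d \<and>
          (\<exists>D :: nat \<Rightarrow> nat \<Rightarrow> 'k.
             (\<forall>i\<in>{1,2}. d (e i) = scl (D 1 1) (e i) + scl (D 5 i) (e 5) + scl (D 6 i) (e 6)) \<and>
             d (e 3) = scl (D 1 1) (e 3) + scl (D 4 3) (e 4) + scl (D 5 3) (e 5) + scl (D 6 3) (e 6) \<and>
             d (e 4) = scl (- (inverse \<gamma> * D 4 3)) (e 3) + scl (D 1 1) (e 4)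
                       + scl (D 5 4) (e 5) + scl (D 6 4) (e 6) \<and>
             d (e 5) = scl (2 * D 1 1) (e 5) \<and>
             d (e 6) = scl (2 * D 1 1) (e 6))}" (is "_ = ?R")
    and "subspaces_isomorphic (fun_scale scl) (derivations scl mul)
      (module_prod.scale (*s) (*s)) (UNIV :: (('k^6) \<times> ('k^4)) set)"
proof -
  note [simp del] = One_nat_def
  have abc: "\<alpha> \<noteq> 0" "\<beta> \<noteq> 0" "\<gamma> \<noteq> 0" and nb: "natural_basis scl mul 6 e"
    and sq: "mul (e 1) (e 1) = e 5" "mul (e 2) (e 2) = scl \<alpha> (e 5) + scl \<beta> (e 6)"
      "mul (e 3) (e 3) = scl \<gamma> (e 6)" "mul (e 4) (e 4) = e 6"
      "mul (e 5) (e 5) = 0" "mul (e 6) (e 6) = 0"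
    using N by (simp_all add: N_6_17_def)
  interpret natural_basis_algebra scl mul 6 e
    using assms(1) nb by (rule natural_basis_algebraI)
  have idx: "{1..6} = {1, 2, 3, 4, 5, 6::nat}" by auto
  show der: "derivations scl mul = ?R"
  proof (intro set_eqI iffI)
    fix d assume d: "d \<in> derivations scl mul"
    then have lin: "Vector_Spaces.linear scl scl d"
      by (simp add: derivations_def)
    let ?D = "\<lambda>j i. coeff (d (e i)) j"
    have diag: "?D 2 2 = ?D 1 1" "?D 4 4 = ?D 1 1"
      using derivation_diagonal_eq[OF two d, of 1 4 2 5 6 \<alpha> \<beta>] abc sq by auto
    moreover have "?D 3 3 = ?D 4 4"
      using derivation_diagonal_eq(2)[OF two d, of 1 4 3 5 6 0 \<gamma>] abc sq by auto
    ultimately have diag3: "?D 3 3 = ?D 1 1" by simp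
    note off = derivation_off_diagonal[OF d]
    have "?D 2 1 = 0" "?D 1 2 = 0"
      using off[of 1 2 5] off[of 1 2 6] abc by (auto simp: sq coeff_simps)
    moreover have "?D 3 1 = 0" "?D 1 3 = 0"
      using off[of 1 3 5] off[of 1 3 6] abc by (auto simp: sq coeff_simps)
    moreover have "?D 4 1 = 0" "?D 1 4 = 0"
      using off[of 1 4 5] off[of 1 4 6] by (auto simp: sq coeff_simps)
    moreover have "?D 3 2 = 0" "?D 2 3 = 0"
      using off[of 2 3 5] off[of 2 3 6] abc by (auto simp: sq coeff_simps)
    moreover have "?D 4 2 = 0" "?D 2 4 = 0"
      using off[of 2 4 5] off[of 2 4 6] abc by (auto simp: sq coeff_simps)
    moreover have "?D 3 4 = - (inverse \<gamma> * ?D 4 3)"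
      using off[of 3 4 6] abc by (auto simp: sq coeff_simps field_simps add_eq_0_iff)
    ultimately have
      "\<forall>i\<in>{1,2}. d (e i) = scl (?D 1 1) (e i) + scl (?D 5 i) (e 5) + scl (?D 6 i) (e 6)"
      "d (e 3) = scl (?D 1 1) (e 3) + scl (?D 4 3) (e 4) + scl (?D 5 3) (e 5) + scl (?D 6 3) (e 6)"
      "d (e 4) = scl (- (inverse \<gamma> * ?D 4 3)) (e 3) + scl (?D 1 1) (e 4)
        + scl (?D 5 4) (e 5) + scl (?D 6 4) (e 6)"
      using basis_expansion[of "d (e 1)"] basis_expansion[of "d (e 2)"]
        basis_expansion[of "d (e 3)"] basis_expansion[of "d (e 4)"] diag diag3
      by (simp_all add: idx algebra_simps)
    moreover have "d (e 5) = scl (2 * ?D 1 1) (e 5)" "d (e 6) = scl (2 * ?D 1 1) (e 6)"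
      using derivation_square[OF d, of 1] derivation_square[OF d, of 4] diag by (simp_all add: sq)
    ultimately show "d \<in> ?R"
      using lin by (intro CollectI conjI exI[of _ ?D])
  next
    fix d assume "d \<in> ?R"
    then obtain D :: "nat \<Rightarrow> nat \<Rightarrow> 'k" where lin: "Vector_Spaces.linear scl scl d"
      and D: "\<forall>i\<in>{1,2}. d (e i) = scl (D 1 1) (e i) + scl (D 5 i) (e 5) + scl (D 6 i) (e 6)"
        "d (e 3) = scl (D 1 1) (e 3) + scl (D 4 3) (e 4) + scl (D 5 3) (e 5) + scl (D 6 3) (e 6)"
        "d (e 4) = scl (- (inverse \<gamma> * D 4 3)) (e 3) + scl (D 1 1) (e 4)
          + scl (D 5 4) (e 5) + scl (D 6 4) (e 6)"
        "d (e 5) = scl (2 * D 1 1) (e 5)" "d (e 6) = scl (2 * D 1 1) (e 6)"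
      by blast
    have "d (x + y) = d x + d y" "d (scl c x) = scl c (d x)" "d 0 = 0" for x y c
      using lin by (simp_all add: Vector_Spaces.linear_iff linear_0)
    moreover have cancel: "\<gamma> * (inverse \<gamma> * x) = x" for x
      using abc by simp
    ultimately show "d \<in> derivations scl mul"
      using D unfolding derivation_iff[OF lin] idx
      using abc by (simp add: cancel coeff_simps sq scale_right_distrib mult_ac)
  qed
  define F :: "(nat \<Rightarrow> nat \<Rightarrow> 'k) \<Rightarrow> nat \<Rightarrow> 'b" where
    "F D i = (if i \<in> {1,2} then scl (D 1 1) (e i) + scl (D 5 i) (e 5) + scl (D 6 i) (e 6)
      else if i = 3 then
        scl (D 1 1) (e 3) + scl (D 4 3) (e 4) + scl (D 5 3) (e 5) + scl (D 6 3) (e 6)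
      else if i = 4 then
        scl (- (inverse \<gamma> * D 4 3)) (e 3) + scl (D 1 1) (e 4) + scl (D 5 4) (e 5) + scl (D 6 4) (e 6)
      else scl (2 * D 1 1) (e i))" for D i
  let ?X = "insert (1, 1) (insert (4, 3) ({5, 6} \<times> {1, 2, 3, 4})) :: (nat \<times> nat) set"
  show "subspaces_isomorphic (fun_scale scl) (derivations scl mul)
      (module_prod.scale (*s) (*s)) (UNIV :: (('k^6) \<times> ('k^4)) set)"
  proof (rule derivations_isomorphic_if_free_entries[where X = ?X and F = F])
    show "derivations scl mul =
        {d. Vector_Spaces.linear scl scl d \<and> (\<exists>D. \<forall>i\<in>{1..6}. d (e i) = F D i)}"
      unfolding der F_def idx by (simp add: conj_assoc)
    show "card ?X = CARD(6) + CARD(4)" by simp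
  qed (auto simp: F_def coeff_simps)
qed

text \<open>The squares of \<open>e\<^sub>2\<close> and \<open>e\<^sub>3\<close> are independent because \<open>\<alpha>\<delta> - \<beta>\<gamma> \<noteq> 0\<close>, and the other pairs
  because the four scalars are nonzero. The free entries are the common diagonal one and the eight that
  lead into the annihilator.\<close>

lemma derivations_N_6_18:
  fixes scl :: "'k::field \<Rightarrow> 'b::ab_group_add \<Rightarrow> 'b"
  assumes "evolution_algebra scl mul" and N: "N_6_18 scl mul e \<alpha> \<beta> \<gamma> \<delta>" and two: "(2::'k) \<noteq> 0"
  shows "derivations scl mul =
      {d. Vector_Spaces.linear scl scl d \<and>
          (\<exists>D :: nat \<Rightarrow> nat \<Rightarrow> 'k.
             (\<forall>i\<in>{1,2,3,4}. d (e i) = scl (D 1 1) (e i) + scl (D 5 i) (e 5) + scl (D 6 i) (e 6)) \<and>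
             d (e 5) = scl (2 * D 1 1) (e 5) \<and>
             d (e 6) = scl (2 * D 1 1) (e 6))}" (is "_ = ?R")
    and "subspaces_isomorphic (fun_scale scl) (derivations scl mul)
      (module_prod.scale (*s) (*s)) (UNIV :: (('k^5) \<times> ('k^4)) set)"
proof -
  note [simp del] = One_nat_def
  have abcd: "\<alpha> \<noteq> 0" "\<beta> \<noteq> 0" "\<gamma> \<noteq> 0" "\<delta> \<noteq> 0" and det: "\<alpha> * \<delta> - \<beta> * \<gamma> \<noteq> 0"
    and nb: "natural_basis scl mul 6 e"
    and sq: "mul (e 1) (e 1) = e 5" "mul (e 2) (e 2) = scl \<alpha> (e 5) + scl \<beta> (e 6)"
      "mul (e 3) (e 3) = scl \<gamma> (e 5) + scl \<delta> (e 6)" "mul (e 4) (e 4) = e 6"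
      "mul (e 5) (e 5) = 0" "mul (e 6) (e 6) = 0"
    using N by (simp_all add: N_6_18_def)
  interpret natural_basis_algebra scl mul 6 e
    using assms(1) nb by (rule natural_basis_algebraI)
  have idx: "{1..6} = {1, 2, 3, 4, 5, 6::nat}" by auto
  show der: "derivations scl mul = ?R"
  proof (intro set_eqI iffI)
    fix d assume d: "d \<in> derivations scl mul"
    then have lin: "Vector_Spaces.linear scl scl d"
      by (simp add: derivations_def)
    let ?D = "\<lambda>j i. coeff (d (e i)) j"
    have diag: "?D 2 2 = ?D 1 1" "?D 4 4 = ?D 1 1"
      using derivation_diagonal_eq[OF two d, of 1 4 2 5 6 \<alpha> \<beta>] abcd sq by auto
    have diag3: "?D 3 3 = ?D 1 1"
      using derivation_diagonal_eq(1)[OF two d, of 1 4 3 5 6 \<gamma> \<delta>] abcd sq by auto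
    note off = derivation_off_diagonal[OF d]
    have "?D 2 1 = 0" "?D 1 2 = 0"
      using off[of 1 2 5] off[of 1 2 6] abcd by (auto simp: sq coeff_simps)
    moreover have "?D 3 1 = 0" "?D 1 3 = 0"
      using off[of 1 3 5] off[of 1 3 6] abcd by (auto simp: sq coeff_simps)
    moreover have "?D 4 1 = 0" "?D 1 4 = 0"
      using off[of 1 4 5] off[of 1 4 6] by (auto simp: sq coeff_simps)
    moreover have "?D 3 2 = 0" "?D 2 3 = 0"
    proof -
      have eqs: "?D 2 3 * \<alpha> + ?D 3 2 * \<gamma> = 0" "?D 2 3 * \<beta> + ?D 3 2 * \<delta> = 0"
        using off[of 2 3 5] off[of 2 3 6] by (simp_all add: sq coeff_simps)
      \<comment> \<open>Cramer's rule for the coefficient matrix with rows \<open>(\<alpha>, \<gamma>)\<close> and \<open>(\<beta>, \<delta>)\<close>\<close>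
      have "?D 3 2 * (\<alpha> * \<delta> - \<beta> * \<gamma>) = 0" "?D 2 3 * (\<alpha> * \<delta> - \<beta> * \<gamma>) = 0"
        using eqs by algebra+
      then show "?D 3 2 = 0" "?D 2 3 = 0"
        using det by simp_all
    qed
    moreover have "?D 4 2 = 0" "?D 2 4 = 0"
      using off[of 2 4 5] off[of 2 4 6] abcd by (auto simp: sq coeff_simps)
    moreover have "?D 4 3 = 0" "?D 3 4 = 0"
      using off[of 3 4 5] off[of 3 4 6] abcd by (auto simp: sq coeff_simps)
    ultimately have "\<forall>i\<in>{1,2,3,4}. d (e i) =
        scl (?D 1 1) (e i) + scl (?D 5 i) (e 5) + scl (?D 6 i) (e 6)"
      using basis_expansion[of "d (e 1)"] basis_expansion[of "d (e 2)"]
        basis_expansion[of "d (e 3)"] basis_expansion[of "d (e 4)"] diag diag3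
      by (simp add: idx add.assoc)
    moreover have "d (e 5) = scl (2 * ?D 1 1) (e 5)" "d (e 6) = scl (2 * ?D 1 1) (e 6)"
      using derivation_square[OF d, of 1] derivation_square[OF d, of 4] diag by (simp_all add: sq)
    ultimately show "d \<in> ?R"
      using lin by (intro CollectI conjI exI[of _ ?D])
  next
    fix d assume "d \<in> ?R"
    then obtain D :: "nat \<Rightarrow> nat \<Rightarrow> 'k" where lin: "Vector_Spaces.linear scl scl d"
      and D: "\<forall>i\<in>{1,2,3,4}. d (e i) = scl (D 1 1) (e i) + scl (D 5 i) (e 5) + scl (D 6 i) (e 6)"
        "d (e 5) = scl (2 * D 1 1) (e 5)" "d (e 6) = scl (2 * D 1 1) (e 6)"
      by blast
    have "d (x + y) = d x + d y" "d (scl c x) = scl c (d x)" "d 0 = 0" for x y c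
      using lin by (simp_all add: Vector_Spaces.linear_iff linear_0)
    with D show "d \<in> derivations scl mul"
      unfolding derivation_iff[OF lin] idx
      by (simp add: coeff_simps sq scale_right_distrib mult_ac)
  qed
  define F :: "(nat \<Rightarrow> nat \<Rightarrow> 'k) \<Rightarrow> nat \<Rightarrow> 'b" where
    "F D i = (if i \<in> {1,2,3,4} then scl (D 1 1) (e i) + scl (D 5 i) (e 5) + scl (D 6 i) (e 6)
      else scl (2 * D 1 1) (e i))" for D i
  let ?X = "insert (1, 1) ({5, 6} \<times> {1, 2, 3, 4}) :: (nat \<times> nat) set"
  show "subspaces_isomorphic (fun_scale scl) (derivations scl mul)
      (module_prod.scale (*s) (*s)) (UNIV :: (('k^5) \<times> ('k^4)) set)"
  proof (rule derivations_isomorphic_if_free_entries[where X = ?X and F = F])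
    show "derivations scl mul =
        {d. Vector_Spaces.linear scl scl d \<and> (\<exists>D. \<forall>i\<in>{1..6}. d (e i) = F D i)}"
      unfolding der F_def idx by simp
    show "card ?X = CARD(5) + CARD(4)" by simp
  qed (auto simp: F_def coeff_simps)
qed

theorem mainTheorem6:
  fixes scl :: "'k::field \<Rightarrow> 'b::ab_group_add \<Rightarrow> 'b"
    and mul :: "'b \<Rightarrow> 'b \<Rightarrow> 'b"
    and e :: "nat \<Rightarrow> 'b"
  assumes char: "CHAR('k) \<noteq> 2"
    and evolution: "evolution_algebra scl mul"
    and indecomposable: "indecomposable scl mul"
    and associative: "associative_algebra mul"
    and nil: "nil_algebra mul"
    and dim: "vector_space.dim scl (UNIV :: 'b set) \<le> 6"
    and dim_ann: "vector_space.dim scl (ann mul) = 2"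
  shows
    "(\<forall>\<alpha> \<beta>. N_5_9 scl mul e \<alpha> \<beta> \<longrightarrow>
        derivations scl mul =
          {d. Vector_Spaces.linear scl scl d \<and>
              (\<exists>D :: nat \<Rightarrow> nat \<Rightarrow> 'k.
                 (\<forall>i\<in>{1,2,3}. d (e i) = scl (D 1 1) (e i) + scl (D 4 i) (e 4) + scl (D 5 i) (e 5)) \<and>
                 d (e 4) = scl (2 * D 1 1) (e 4) \<and>
                 d (e 5) = scl (2 * D 1 1) (e 5))} \<and>
        subspaces_isomorphic (fun_scale scl) (derivations scl mul)
          (module_prod.scale (*s) (*s)) (UNIV :: (('k^4) \<times> ('k^3)) set))
   \<and> (\<forall>\<alpha> \<beta> \<gamma>. N_6_17 scl mul e \<alpha> \<beta> \<gamma> \<longrightarrow>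
        derivations scl mul =
          {d. Vector_Spaces.linear scl scl d \<and>
              (\<exists>D :: nat \<Rightarrow> nat \<Rightarrow> 'k.
                 (\<forall>i\<in>{1,2}. d (e i) = scl (D 1 1) (e i) + scl (D 5 i) (e 5) + scl (D 6 i) (e 6)) \<and>
                 d (e 3) = scl (D 1 1) (e 3) + scl (D 4 3) (e 4) + scl (D 5 3) (e 5) + scl (D 6 3) (e 6) \<and>
                 d (e 4) = scl (- (inverse \<gamma> * D 4 3)) (e 3) + scl (D 1 1) (e 4)
                           + scl (D 5 4) (e 5) + scl (D 6 4) (e 6) \<and>
                 d (e 5) = scl (2 * D 1 1) (e 5) \<and>
                 d (e 6) = scl (2 * D 1 1) (e 6))} \<and>
        subspaces_isomorphic (fun_scale scl) (derivations scl mul)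
          (module_prod.scale (*s) (*s)) (UNIV :: (('k^6) \<times> ('k^4)) set))
   \<and> (\<forall>\<alpha> \<beta> \<gamma> \<delta>. N_6_18 scl mul e \<alpha> \<beta> \<gamma> \<delta> \<longrightarrow>
        derivations scl mul =
          {d. Vector_Spaces.linear scl scl d \<and>
              (\<exists>D :: nat \<Rightarrow> nat \<Rightarrow> 'k.
                 (\<forall>i\<in>{1,2,3,4}. d (e i) = scl (D 1 1) (e i) + scl (D 5 i) (e 5) + scl (D 6 i) (e 6)) \<and>
                 d (e 5) = scl (2 * D 1 1) (e 5) \<and>
                 d (e 6) = scl (2 * D 1 1) (e 6))} \<and>
        subspaces_isomorphic (fun_scale scl) (derivations scl mul)
          (module_prod.scale (*s) (*s)) (UNIV :: (('k^5) \<times> ('k^4)) set))"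
  using derivations_N_5_9[OF evolution _ two_neq_zero_if_CHAR_neq_2[OF char]]
    derivations_N_6_17[OF evolution _ two_neq_zero_if_CHAR_neq_2[OF char]]
    derivations_N_6_18[OF evolution _ two_neq_zero_if_CHAR_neq_2[OF char]]
  by (intro conjI allI impI)

end
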